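(* Let $(W,R)$ be a Coxeter system with $R$ finite. Then the minimum of the involution lengths $\ell_{\mathrm{inv}}(w)$, taken over all Coxeter elements $w$ of $W$, equals the chromatic number $\chi(\Gamma)$ of the Coxeter graph $\Gamma$ of $W$.
   Context: $(W,R)$ is a Coxeter system with set $R$ of simple reflections, and $\ell$ is the length function with respect to $R$. The Coxeter graph $\Gamma$ has vertex set $R$, with distinct $r,s\in R$ joined by an edge if and only if $rs\neq sr$ (edge labels are irrelevant here). A Coxeter element of $W$ is a product of all the simple reflections in some order, with each $r\in R$ appearing exactly once. An element $u\in W$ is a prefix of $w$ if $w=uv$ for some $v\in W$ with $\ell(w)=\ell(u)+\ell(v)$. An involution is an element of order exactly $2$. Let $\mathcal{IP}(w)$ be the set of prefixes of $w$ that are involutions, and let $A(w)=\{u\in\mathcal{IP}(w):\ell(u)=\max_{v\in\mathcal{IP}(w)}\ell(v)\}$. If $w\ne 1$ and $|A(w)|=1$, the unique element of $A(w)$ is called the ancestor of $w$ and denoted $a(w)$. The ancestor decomposition of $w\neq 1$ is the expression $w=a_1a_2\cdots a_k$ with $a_i=a(a_ia_{i+1}\cdots a_k)$ for each $1\le i\le k$; that is, one repeatedly splits off the ancestor on the left, until nothing remains. The involution length $\ell_{\mathrm{inv}}(w)$ is the number $k$ of terms in this decomposition, with $\ell_{\mathrm{inv}}(1)=0$. For a Coxeter element $w$ of $W$ the ancestor decomposition exists and is unique: every non-identity Coxeter element of a Coxeter group of finite rank has a unique ancestor, equal to the product of the pairwise commuting simple reflections in its left descent set $D(w)=\{r\in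 R:\ell(rw)<\ell(w)\}$, and $a(w)^{-1}w$ is a Coxeter element of the standard parabolic subgroup generated by $R\setminus D(w)$. Hence $\ell_{\mathrm{inv}}(w)$ is well defined. *)

theory Defs
  imports "HOL-Algebra.Multiplicative_Group"
begin

section \<open>Words and Coxeter systems\<close>

context group
begin

definition word_prod :: "'a list \<Rightarrow> 'a" where
  "word_prod xs = foldr (\<otimes>) xs \<one>"

text \<open>
  A step inserts the word \<open>(r s)\<^sup>m\<close> with \<open>m\<close> the order of \<open>r \<otimes> s\<close>. If that order is
  infinite, \<open>ord (r \<otimes> s) = 0\<close>, the inserted word is empty and the step imposes no relation.
\<close>

inductive coxeter_step :: "'a set \<Rightarrow> 'a list \<Rightarrow> 'a list \<Rightarrow> bool" for R where
  "\<lbrakk>xs \<in> lists R; ys \<in> lists R; r \<in> R; s \<in> R\<rbrakk> \<Longrightarrow>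
     coxeter_step R (xs @ ys) (xs @ concat (replicate (ord (r \<otimes> s)) [r, s]) @ ys)"

end

text \<open>
  The last axiom states that \<open>W\<close> has the presentation
  \<open>\<langle>R | (r s)\<^bsup>m(r,s)\<^esup> = 1 whenever m(r,s) is finite\<rangle>\<close>, where \<open>m(r,s)\<close> is the order of \<open>r s\<close>.
  Since \<open>m(r,r) = 1\<close> the relators include \<open>r r\<close>, so every generator is its own inverse
  and the group presentation may be written with words in \<open>R\<close> alone, without formal inverses.
\<close>

locale coxeter_system = group W for W (structure) +
  fixes R :: "'a set"
  assumes generators_closed: "R \<subseteq> carrier W"
    and generators_order: "r \<in> R \<Longrightarrow> ord r = 2"
    and generates: "generate W R = carrier W"
    and presentation:
      "\<lbrakk>xs \<in> lists R; ys \<in> lists R; word_prod xs = word_prod ys\<rbrakk> \<Longrightarrow>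
         equivclp (coxeter_step R) xs ys"
begin

definition word_length :: "'a \<Rightarrow> nat" where
  "word_length w = (LEAST n. \<exists>xs \<in> lists R. length xs = n \<and> word_prod xs = w)"

definition coxeter_elements :: "'a set" where
  "coxeter_elements = {word_prod xs | xs. distinct xs \<and> set xs = R}"

definition coxeter_graph_edges :: "'a set set" where
  "coxeter_graph_edges = {{r, s} | r s. r \<in> R \<and> s \<in> R \<and> r \<noteq> s \<and> r \<otimes> s \<noteq> s \<otimes> r}"


section \<open>Ancestors and involution length\<close>

definition is_prefix :: "'a \<Rightarrow> 'a \<Rightarrow> bool" where
  "is_prefix u w \<longleftrightarrow> u \<in> carrier W \<and>
     (\<exists>v \<in> carrier W. w = u \<otimes> v \<and> word_length w = word_length u + word_length v)"

definition involution_prefixes :: "'a \<Rightarrow> 'a set" where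
  "involution_prefixes w = {u. is_prefix u w \<and> ord u = 2}"

text \<open>The lengths of prefixes of \<open>w\<close> are bounded by that of \<open>w\<close>, so \<open>Max\<close> is over a finite set.\<close>

definition longest_involution_prefixes :: "'a \<Rightarrow> 'a set" where
  "longest_involution_prefixes w =
     {u \<in> involution_prefixes w. word_length u = Max (word_length ` involution_prefixes w)}"

definition has_ancestor :: "'a \<Rightarrow> bool" where
  "has_ancestor w \<longleftrightarrow> w \<noteq> \<one> \<and> card (longest_involution_prefixes w) = 1"

definition ancestor :: "'a \<Rightarrow> 'a" where
  "ancestor w = the_elem (longest_involution_prefixes w)"

text \<open>The identity has the empty decomposition, and no other.\<close>

definition ancestor_decomposition :: "'a \<Rightarrow> 'a list \<Rightarrow> bool" where
  "ancestor_decomposition w us \<longleftrightarrow> word_prod us = w \<and>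
     (\<forall>i < length us. has_ancestor (word_prod (drop i us)) \<and>
                      us ! i = ancestor (word_prod (drop i us)))"

text \<open>
  An element has at most one ancestor decomposition; the value is unspecified if it has none.
\<close>

definition involution_length :: "'a \<Rightarrow> nat" where
  "involution_length w = length (THE us. ancestor_decomposition w us)"

end


section \<open>Chromatic number\<close>

definition proper_colouring :: "'v set \<Rightarrow> 'v set set \<Rightarrow> nat \<Rightarrow> ('v \<Rightarrow> nat) \<Rightarrow> bool" where
  "proper_colouring V E k c \<longleftrightarrow>
     c ` V \<subseteq> {..<k} \<and> (\<forall>u \<in> V. \<forall>v \<in> V. {u, v} \<in> E \<longrightarrow> c u \<noteq> c v)"

definition chromatic_number :: "'v set \<Rightarrow> 'v set set \<Rightarrow> nat" where
  "chromatic_number V E = (LEAST k. \<exists>c. proper_colouring V E k c)"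

end

theory Submission
  imports Defs
begin

text \<open>
  Write a Coxeter element as the product of a word \<open>xs\<close> in which every simple reflection occurs
  once, and call a letter of \<open>xs\<close> a source if it commutes with all letters before it. The sources
  commute pairwise and can be moved to the front. The ancestor is their product
  (\<open>ancestor_distinct_word\<close>), so splitting off ancestors peels \<open>xs\<close> layer by layer and the
  involution length is the number of layers (\<open>involution_length_rec\<close>). Each layer is an
  independent set of the Coxeter graph, so numbering the layers gives a proper colouring, and the
  involution length is at least the chromatic number (\<open>colouring_from_word\<close>). Conversely, if the
  letters of \<open>xs\<close> are sorted by a proper colouring, then all letters of the lowest remaining
  colour are sources, so there are at most as many layers as colours
  (\<open>involution_length_sorted_le\<close>).

  The identification of the ancestor rests on how little freedom the reduced words of a product
  without repeated letters have. The tool is the sequence of reflections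
  \<open>x\<^sub>1 \<dots> x\<^sub>i\<^sub>-\<^sub>1 x\<^sub>i x\<^sub>i\<^sub>-\<^sub>1 \<dots> x\<^sub>1\<close> of a word. The parity with which a given element occurs in it is
  unchanged by inserting a relator, because the reflections of \<open>(r s)\<^sup>m\<close> run twice through the same
  \<open>m\<close> elements; by the presentation it depends only on the product of the word
  (\<open>reflections_parity\<close>). Hence the reduced words are those whose reflections are distinct, and
  two reduced words of the same element have the same reflections and the same set of letters.
  Words without repeated letters are reduced, an exchange argument shows that the first letter of
  one of them commutes with all letters before it in any other with the same product
  (\<open>exchange_distinct\<close>, \<open>commute_letters\<close>), and an involution with such a word, being also the product of the reversed
  word, must have pairwise commuting letters (\<open>involution_letters_commute\<close>). So every involution
  that is a prefix is a product of sources, and the longest one uses them all.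
\<close>

context coxeter_system
begin

section \<open>Products of words\<close>

lemma word_prod_Nil [simp]: "word_prod [] = \<one>"
  by (simp add: word_prod_def)

lemma word_prod_Cons [simp]: "word_prod (x # xs) = x \<otimes> word_prod xs"
  by (simp add: word_prod_def)

lemma word_prod_closed [simp]: "set xs \<subseteq> carrier W \<Longrightarrow> word_prod xs \<in> carrier W"
  by (induction xs) auto

lemma word_prod_append [simp]:
  "\<lbrakk>set xs \<subseteq> carrier W; set ys \<subseteq> carrier W\<rbrakk> \<Longrightarrow>
     word_prod (xs @ ys) = word_prod xs \<otimes> word_prod ys"
  by (induction xs) (auto simp: m_assoc)

lemma R_carrier [simp]: "r \<in> R \<Longrightarrow> r \<in> carrier W"
  using generators_closed by auto

lemma sub_R_carrier: "A \<subseteq> R \<Longrightarrow> A \<subseteq> carrier W"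
  using generators_closed by auto

lemma generator_square [simp]: "r \<in> R \<Longrightarrow> r \<otimes> r = \<one>"
  using pow_ord_eq_1[of r] generators_order[of r] by (simp add: numeral_2_eq_2)

lemma generator_neq_one: "r \<in> R \<Longrightarrow> r \<noteq> \<one>"
  using generators_order[of r] by (auto simp: ord_eq_1[of \<one>, simplified] dest: sym)

lemma inv_generator [simp]: "r \<in> R \<Longrightarrow> inv r = r"
  by (simp add: inv_equality)

lemma mult_cancel_inner [simp]:
  assumes "x \<in> carrier W" "y \<in> carrier W"
  shows "x \<otimes> (inv x \<otimes> y) = y" "inv x \<otimes> (x \<otimes> y) = y"
  using assms by (simp_all flip: m_assoc)

lemma generator_cancel: "\<lbrakk>r \<in> R; y \<in> carrier W\<rbrakk> \<Longrightarrow> r \<otimes> (r \<otimes> y) = y"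
  by (simp flip: m_assoc)

lemma inv_word_prod: "set xs \<subseteq> R \<Longrightarrow> inv (word_prod xs) = word_prod (rev xs)"
  by (induction xs) (auto simp: inv_mult_group sub_R_carrier)

lemma word_prod_surj:
  assumes "w \<in> carrier W"
  obtains xs where "set xs \<subseteq> R" "word_prod xs = w"
proof -
  have "w \<in> generate W R"
    using assms generates by simp
  then have "\<exists>xs. set xs \<subseteq> R \<and> word_prod xs = w"
  proof (induction rule: generate.induct)
    case one
    show ?case by (rule exI[of _ "[]"]) simp
  next
    case (incl r)
    then show ?case by (intro exI[of _ "[r]"]) simp
  next
    case (inv r)
    then show ?case by (intro exI[of _ "[r]"]) simp
  next
    case (eng u v)
    then obtain xs ys where "set xs \<subseteq> R" "word_prod xs = u" "set ys \<subseteq> R" "word_prod ys = v"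
      by auto
    then show ?case by (intro exI[of _ "xs @ ys"]) (simp add: sub_R_carrier)
  qed
  then show thesis using that by auto
qed

lemma word_prod_commute:
  assumes "x \<in> carrier W" "set p \<subseteq> carrier W" "\<forall>y\<in>set p. x \<otimes> y = y \<otimes> x"
  shows "x \<otimes> word_prod p = word_prod p \<otimes> x"
  using assms(2,3)
proof (induction p)
  case (Cons y p)
  have "x \<otimes> (y \<otimes> word_prod p) = y \<otimes> (x \<otimes> word_prod p)"
    using Cons.prems assms(1) m_assoc[of x y "word_prod p"] m_assoc[of y x "word_prod p"] by simp
  also have "\<dots> = y \<otimes> word_prod p \<otimes> x"
    using Cons assms(1) by (simp add: m_assoc)
  finally show ?case by simp
qed (use assms in simp)


section \<open>Reflection sequences and reduced words\<close>

text \<open>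
  The \<open>i\<close>-th entry is the conjugate of the \<open>i\<close>-th letter by the product of the letters before
  it. For a reduced word these are the left inversions of its product. Deleting that letter from
  the word multiplies the product on the left by this entry.
\<close>

primrec reflections :: "'a list \<Rightarrow> 'a list" where
  "reflections [] = []"
| "reflections (x # xs) = x # map (\<lambda>t. x \<otimes> t \<otimes> inv x) (reflections xs)"

lemma length_reflections [simp]: "length (reflections xs) = length xs"
  by (induction xs) auto

lemma reflections_closed [simp]:
  "set xs \<subseteq> carrier W \<Longrightarrow> set (reflections xs) \<subseteq> carrier W"
  by (induction xs) auto

lemma reflection_closed:
  "\<lbrakk>t \<in> set (reflections xs); set xs \<subseteq> carrier W\<rbrakk> \<Longrightarrow> t \<in> carrier W"
  using reflections_closed by blast

lemma reflections_append:
  "\<lbrakk>set xs \<subseteq> carrier W; set ys \<subseteq> carrier W\<rbrakk> \<Longrightarrow> reflections (xs @ ys) =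
     reflections xs @ map (\<lambda>t. word_prod xs \<otimes> t \<otimes> inv (word_prod xs)) (reflections ys)"
proof (induction xs)
  case Nil
  then show ?case
    by (auto simp: reflection_closed intro!: map_idI[symmetric])
next
  case (Cons x xs)
  then show ?case
    by (auto simp: m_assoc inv_mult_group reflection_closed)
qed

lemma in_reflections_iff:
  assumes "set xs \<subseteq> carrier W"
  shows "t \<in> set (reflections xs) \<longleftrightarrow>
    (\<exists>p x q. xs = p @ x # q \<and> t = word_prod p \<otimes> x \<otimes> inv (word_prod p))"
proof
  assume "t \<in> set (reflections xs)"
  then show "\<exists>p x q. xs = p @ x # q \<and> t = word_prod p \<otimes> x \<otimes> inv (word_prod p)"
    using assms
  proof (induction xs arbitrary: t)
    case (Cons x xs)
    show ?case
    proof (cases "t = x")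
      case True
      then show ?thesis using Cons.prems by (intro exI[of _ "[]"]) simp
    next
      case False
      then obtain t' where t': "t' \<in> set (reflections xs)" "t = x \<otimes> t' \<otimes> inv x"
        using Cons.prems by auto
      then obtain p y q where
        "xs = p @ y # q" "t' = word_prod p \<otimes> y \<otimes> inv (word_prod p)"
        using Cons.IH[of t'] Cons.prems by auto
      then show ?thesis using t' Cons.prems
        by (intro exI[of _ "x # p"] exI[of _ y] exI[of _ q])
          (simp add: m_assoc inv_mult_group)
    qed
  qed simp
next
  assume "\<exists>p x q. xs = p @ x # q \<and> t = word_prod p \<otimes> x \<otimes> inv (word_prod p)"
  then show "t \<in> set (reflections xs)"
    using assms by (auto simp: reflections_append)
qed

text \<open>
  Conjugation by \<open>r s\<close> carries \<open>(r s)\<^sup>i r\<close> to \<open>(r s)\<^bsup>i+2\<^esup> r\<close>, since \<open>r\<close> inverts \<open>r s\<close>. The exponents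
  therefore run through all numbers below the length of the word, and when \<open>(r s)\<^sup>m = 1\<close> the second
  half of the sequence repeats the first.
\<close>

lemma reflections_dihedral:
  assumes "r \<in> R" "s \<in> R"
  shows "reflections (concat (replicate m [r, s])) =
           map (\<lambda>i. (r \<otimes> s) [^] i \<otimes> r) [0..<2 * m]"
proof (induction m)
  case (Suc m)
  have shift: "r \<otimes> (s \<otimes> ((r \<otimes> s) [^] i \<otimes> r) \<otimes> s) \<otimes> r = (r \<otimes> s) [^] Suc (Suc i) \<otimes> r" for i :: nat
  proof -
    have "r \<otimes> (s \<otimes> ((r \<otimes> s) [^] i \<otimes> r) \<otimes> s) \<otimes> r = (r \<otimes> s) \<otimes> (r \<otimes> s) [^] i \<otimes> (r \<otimes> s) \<otimes> r"
      using assms by (simp add: m_assoc)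
    then show ?thesis
      using assms nat_pow_Suc2[of "r \<otimes> s" i] by simp
  qed
  have "[0..<2 * Suc m] = 0 # 1 # map (\<lambda>i. Suc (Suc i)) [0..<2 * m]"
    using map_add_upt[of 2 "2 * m"] by (simp add: upt_conv_Cons numeral_2_eq_2 del: upt_Suc)
  then show ?case
    using assms Suc shift by (simp add: o_def m_assoc del: nat_pow_Suc)
qed simp

text \<open>
  The product of the inserted word \<open>z\<close> is trivial, so the reflections of the letters around it do
  not change. Those of \<open>z\<close> itself form a list \<open>l @ l\<close>, up to conjugation, and contribute an even
  number of occurrences. If \<open>r s\<close> has infinite order, \<open>z\<close> and \<open>l\<close> are empty.
\<close>

lemma coxeter_step_parity:
  assumes "coxeter_step R xs ys"
  shows "even (count_list (reflections xs) t) = even (count_list (reflections ys) t)"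
  using assms
proof (cases rule: coxeter_step.cases)
  case (1 us vs r s)
  define m where "m = ord (r \<otimes> s)"
  define z where "z = concat (replicate m [r, s])"
  define l where "l = map (\<lambda>i. (r \<otimes> s) [^] i \<otimes> r) [0..<m]"
  have sub: "set us \<subseteq> carrier W" "set vs \<subseteq> carrier W" "set z \<subseteq> carrier W"
    using 1 by (auto simp: z_def)
  have rs: "r \<otimes> s \<in> carrier W" "(r \<otimes> s) [^] m = \<one>"
    using 1 by (simp_all add: m_def)
  have "word_prod (concat (replicate k [r, s])) = (r \<otimes> s) [^] k" for k
  proof (induction k)
    case (Suc k)
    then show ?case
      using 1 nat_pow_Suc2[of "r \<otimes> s" k] by (simp add: m_assoc)
  qed simp
  then have z1: "word_prod z = \<one>"
    using rs by (simp add: z_def)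
  have "[0..<2 * m] = [0..<m] @ map (\<lambda>i. m + i) [0..<m]"
    by (rule nth_equalityI) (auto simp: nth_append)
  moreover have "(r \<otimes> s) [^] (m + i) = (r \<otimes> s) [^] i" for i
    using rs by (simp flip: nat_pow_mult)
  ultimately have zl: "reflections z = l @ l"
    using reflections_dihedral[of r s m] 1 by (simp add: z_def l_def o_def)
  have "reflections (z @ vs) = reflections z @ reflections vs"
    using sub z1 by (auto simp: reflections_append reflection_closed intro!: map_idI)
  then have "reflections (us @ z @ vs) = reflections us @
      map (\<lambda>t. word_prod us \<otimes> t \<otimes> inv (word_prod us)) (l @ l @ reflections vs)"
    using sub zl by (simp add: reflections_append[of us])
  moreover have "ys = us @ z @ vs" "xs = us @ vs"
    using 1 by (simp_all add: z_def m_def)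
  moreover have "reflections xs = reflections us @
      map (\<lambda>t. word_prod us \<otimes> t \<otimes> inv (word_prod us)) (reflections vs)"
    using sub 1 by (simp add: reflections_append)
  ultimately show ?thesis
    by auto
qed

lemma reflections_parity:
  assumes "set xs \<subseteq> R" "set ys \<subseteq> R" "word_prod xs = word_prod ys"
  shows "even (count_list (reflections xs) t) = even (count_list (reflections ys) t)"
proof -
  have "equivclp (coxeter_step R) xs ys"
    using presentation[of xs ys] assms by auto
  then show ?thesis
    by (induction rule: equivclp_induct) (auto dest: coxeter_step_parity)
qed

text \<open>
  An element that occurs exactly once among the reflections of one word occurs an odd number of
  times, hence at least once, among those of any other word with the same product.
\<close>

lemma reflections_subset:
  assumes "set xs \<subseteq> R" "set ys \<subseteq> R" "word_prod xs = word_prod ys" "distinct (reflections xs)"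
  shows "set (reflections xs) \<subseteq> set (reflections ys)"
proof
  fix t assume "t \<in> set (reflections xs)"
  moreover have "count_list l t = 1" if "distinct l" "t \<in> set l" for l
    using that by (induction l) auto
  ultimately have "count_list (reflections xs) t = 1"
    using assms(4) by blast
  then have "odd (count_list (reflections ys) t)"
    using reflections_parity[OF assms(1-3), of t] by simp
  then show "t \<in> set (reflections ys)"
    by (metis count_list_0_iff even_zero)
qed

lemma distinct_reflections_Cons:
  assumes "x \<in> R" "set xs \<subseteq> R"
  shows "distinct (reflections (x # xs)) \<longleftrightarrow> distinct (reflections xs) \<and> x \<notin> set (reflections xs)"
proof -
  have sub: "set (reflections xs) \<subseteq> carrier W"
    using assms by (simp add: sub_R_carrier)
  define f where "f t = x \<otimes> t \<otimes> inv x" for t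
  have inj: "inj_on f (carrier W)"
    using assms by (intro inj_onI) (simp add: f_def)
  have "f x = x"
    using assms by (simp add: f_def)
  then have "x \<in> f ` set (reflections xs) \<longleftrightarrow> x \<in> set (reflections xs)"
    using inj_on_image_mem_iff[OF inj, of x "set (reflections xs)"] assms sub by simp
  moreover have "inj_on f (set (reflections xs))"
    using inj sub by (rule inj_on_subset)
  moreover have rec: "reflections (x # xs) = x # map f (reflections xs)"
    by (simp add: f_def[abs_def])
  ultimately show ?thesis
    unfolding rec by (auto simp: distinct_map)
qed

text \<open>
  If \<open>x\<close> recurs among the reflections of the word \<open>p y q\<close> after it, then \<open>x p = p y\<close>, so the product
  of \<open>x p y q\<close> is that of \<open>p y y q\<close>, which is that of \<open>p q\<close>.
\<close>

lemma deletion: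
  assumes "set xs \<subseteq> R" "\<not> distinct (reflections xs)"
  shows "\<exists>ys. set ys \<subseteq> set xs \<and> length ys < length xs \<and> word_prod ys = word_prod xs"
  using assms
proof (induction xs)
  case (Cons x xs)
  show ?case
  proof (cases "distinct (reflections xs)")
    case False
    then obtain ys where "set ys \<subseteq> set xs" "length ys < length xs" "word_prod ys = word_prod xs"
      using Cons by auto
    then show ?thesis by (intro exI[of _ "x # ys"]) auto
  next
    case True
    then have "x \<in> set (reflections xs)"
      using Cons.prems distinct_reflections_Cons[of x xs] by (auto simp del: reflections.simps)
    then obtain p y q where xs: "xs = p @ y # q" and x: "x = word_prod p \<otimes> y \<otimes> inv (word_prod p)"
      using Cons.prems in_reflections_iff[of xs x] by (auto simp: sub_R_carrier)
    have sub: "set p \<subseteq> carrier W" "set q \<subseteq> carrier W" "y \<in> R"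
      using Cons.prems xs by (auto simp: sub_R_carrier)
    have "word_prod (x # xs) = word_prod (p @ q)"
      using sub by (simp add: xs x m_assoc generator_cancel)
    then show ?thesis
      using xs by (intro exI[of _ "p @ q"]) auto
  qed
qed simp

lemma distinct_reflections_word:
  assumes "set xs \<subseteq> R"
  obtains ys where "set ys \<subseteq> set xs" "word_prod ys = word_prod xs" "distinct (reflections ys)"
proof -
  have "\<exists>ys. set ys \<subseteq> set xs \<and> word_prod ys = word_prod xs \<and> distinct (reflections ys)"
    using assms
  proof (induction xs rule: length_induct)
    case (1 xs)
    show ?case
    proof (cases "distinct (reflections xs)")
      case False
      then obtain ys where "set ys \<subseteq> set xs" "length ys < length xs" "word_prod ys = word_prod xs"
        using deletion 1 by blast
      then show ?thesis
        using 1 by (metis subset_trans)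
    qed auto
  qed
  then show thesis using that by blast
qed

lemma distinct_reflections_minimal:
  assumes "set xs \<subseteq> R" "set ys \<subseteq> R" "word_prod xs = word_prod ys" "distinct (reflections xs)"
  shows "length xs \<le> length ys"
proof -
  have "card (set (reflections xs)) \<le> card (set (reflections ys))"
    using reflections_subset[OF assms] by (simp add: card_mono)
  also have "\<dots> \<le> length ys"
    using card_length[of "reflections ys"] by simp
  finally show ?thesis
    using distinct_card[OF assms(4)] by simp
qed

lemma word_length_eq:
  assumes "set xs \<subseteq> R" "distinct (reflections xs)"
  shows "word_length (word_prod xs) = length xs"
  unfolding word_length_def
proof (rule Least_equality)
  show "\<exists>ys\<in>lists R. length ys = length xs \<and> word_prod ys = word_prod xs"
    using assms by auto
  show "length xs \<le> n" if "\<exists>ys\<in>lists R. length ys = n \<and> word_prod ys = word_prod xs" for n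
    using that distinct_reflections_minimal[OF assms(1) _ _ assms(2)] by (auto simp: subset_iff)
qed

lemma minimal_distinct_reflections:
  assumes "set xs \<subseteq> R" "word_length (word_prod xs) = length xs"
  shows "distinct (reflections xs)"
proof (rule ccontr)
  assume "\<not> distinct (reflections xs)"
  then obtain ys where "set ys \<subseteq> set xs" "length ys < length xs" "word_prod ys = word_prod xs"
    using deletion assms by blast
  moreover from this have "word_length (word_prod xs) \<le> length ys"
    unfolding word_length_def using assms by (intro Least_le) auto
  ultimately show False using assms by simp
qed

lemma reduced_word:
  assumes "w \<in> carrier W"
  obtains xs where "set xs \<subseteq> R" "word_prod xs = w" "word_length w = length xs"
proof -
  obtain xs where "set xs \<subseteq> R" "word_prod xs = w"
    using word_prod_surj[OF assms] .
  moreover from this obtain ys where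
    "set ys \<subseteq> set xs" "word_prod ys = word_prod xs" "distinct (reflections ys)"
    using distinct_reflections_word by blast
  ultimately show thesis
    using that[of ys] word_length_eq[of ys] by auto
qed


section \<open>Words without repeated letters\<close>

text \<open>
  Deletion only removes letters, so \<open>r\<close> has a word with distinct reflections among the letters of
  \<open>xs\<close>; like \<open>[r]\<close> it has length one. This is the independence of the simple reflections: none
  lies in the subgroup generated by the others.
\<close>

lemma generator_in_word:
  assumes "r \<in> R" "set xs \<subseteq> R" "word_prod xs = r"
  shows "r \<in> set xs"
proof -
  obtain ys where ys: "set ys \<subseteq> set xs" "word_prod ys = r" "distinct (reflections ys)"
    using distinct_reflections_word assms by metis
  have "length ys \<le> length [r]"
    using assms ys by (intro distinct_reflections_minimal) auto
  moreover have "ys \<noteq> []"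
    using ys generator_neq_one[OF assms(1)] by auto
  ultimately obtain s where "ys = [s]"
    by (cases ys) auto
  then show ?thesis using ys assms by auto
qed

lemma conjugate_in_word:
  assumes "set p \<subseteq> R" "x \<in> R" "y \<in> R" "x = word_prod p \<otimes> y \<otimes> inv (word_prod p)"
  shows "x \<in> insert y (set p)"
proof -
  have "word_prod (p @ y # rev p) = x"
    using assms by (simp add: inv_word_prod sub_R_carrier m_assoc)
  then show ?thesis
    using generator_in_word[of x "p @ y # rev p"] assms by auto
qed

text \<open>
  At the first letter \<open>y\<close> of \<open>ys\<close> outside \<open>xs\<close>, the reflection is also one of \<open>xs\<close>. Conjugating it
  back by the letters before \<open>y\<close>, which occur in \<open>xs\<close>, writes \<open>y\<close> as a product of letters of \<open>xs\<close>,
  against the independence of the simple reflections.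
\<close>

lemma support_subset:
  assumes "set xs \<subseteq> R" "set ys \<subseteq> R" "word_prod ys = word_prod xs" "distinct (reflections ys)"
  shows "set ys \<subseteq> set xs"
proof (rule ccontr)
  assume "\<not> set ys \<subseteq> set xs"
  then have "\<exists>y\<in>set ys. y \<notin> set xs" by auto
  then obtain p y q where ys: "ys = p @ y # q" and y: "y \<notin> set xs" and p: "set p \<subseteq> set xs"
    using split_list_first_prop[of ys "\<lambda>y. y \<notin> set xs"] by auto
  have sub: "set p \<subseteq> R" "y \<in> R"
    using ys assms by auto
  define t where "t = word_prod p \<otimes> y \<otimes> inv (word_prod p)"
  have "t \<in> set (reflections ys)"
    using ys assms(2) by (auto simp: t_def in_reflections_iff sub_R_carrier)
  then have "t \<in> set (reflections xs)"
    using reflections_subset[OF assms(2,1,3,4)] by auto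
  then obtain p' x q' where xs: "xs = p' @ x # q'" and t: "t = word_prod p' \<otimes> x \<otimes> inv (word_prod p')"
    using assms(1) by (auto simp: in_reflections_iff sub_R_carrier)
  have sub': "set p' \<subseteq> R" "x \<in> R"
    using xs assms by auto
  have "y = inv (word_prod p) \<otimes> t \<otimes> word_prod p"
    using sub by (simp add: t_def m_assoc sub_R_carrier)
  also have "\<dots> = word_prod (rev p @ p' @ x # rev p' @ p)"
    using sub sub' by (simp add: t inv_word_prod m_assoc sub_R_carrier)
  finally have "y \<in> set (rev p @ p' @ x # rev p' @ p)"
    using sub sub' by (intro generator_in_word) auto
  then show False
    using y p xs by auto
qed

text \<open>
  A repeated reflection would express one letter through later ones, all different from it.
\<close>

lemma distinct_word_reduced:
  assumes "set xs \<subseteq> R" "distinct xs"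
  shows "distinct (reflections xs)"
  using assms
proof (induction xs)
  case (Cons x xs)
  have "x \<notin> set (reflections xs)"
  proof
    assume "x \<in> set (reflections xs)"
    then obtain p y q where "xs = p @ y # q" "x = word_prod p \<otimes> y \<otimes> inv (word_prod p)"
      using Cons.prems by (auto simp: in_reflections_iff sub_R_carrier)
    then show False
      using conjugate_in_word[of p x y] Cons.prems by auto
  qed
  then show ?case
    using Cons distinct_reflections_Cons[of x xs] by auto
qed simp

lemma word_length_distinct:
  "\<lbrakk>set xs \<subseteq> R; distinct xs\<rbrakk> \<Longrightarrow> word_length (word_prod xs) = length xs"
  by (simp add: word_length_eq distinct_word_reduced)

lemma same_length_distinct:
  assumes "set xs \<subseteq> R" "distinct xs" "set ys \<subseteq> R" "word_prod ys = word_prod xs"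
    and "length ys = length xs"
  shows "distinct ys" "set ys = set xs"
proof -
  have dys: "distinct (reflections ys)"
    using assms word_length_distinct[of xs] by (intro minimal_distinct_reflections) simp_all
  have "set ys \<subseteq> set xs" "set xs \<subseteq> set ys"
    using assms support_subset[of xs ys] support_subset[of ys xs] dys distinct_word_reduced[of xs]
    by auto
  then show "set ys = set xs" by simp
  then show "distinct ys"
    using assms by (metis card_distinct distinct_card)
qed

text \<open>
  As \<open>s\<close> is a reflection of \<open>s us\<close>, it is one of \<open>ys = p y q\<close>, which means \<open>s p = p y\<close>. Here \<open>p y\<close>
  has no repeated letters, so \<open>s p\<close>, of the same length, has the same set of letters and no
  repetition either. This leaves only \<open>y = s\<close>.
\<close>

lemma exchange_distinct:
  assumes "set (s # us) \<subseteq> R" "set ys \<subseteq> R" "distinct (s # us)" "distinct ys"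
    and "word_prod ys = word_prod (s # us)"
  obtains p q where "ys = p @ s # q" "s \<otimes> word_prod p = word_prod p \<otimes> s"
proof -
  have "s \<in> set (reflections ys)"
    using reflections_subset[of "s # us" ys] distinct_word_reduced[of "s # us"] assms by auto
  then obtain p y q where ys: "ys = p @ y # q" and s: "s = word_prod p \<otimes> y \<otimes> inv (word_prod p)"
    using assms by (auto simp: in_reflections_iff sub_R_carrier)
  have sub: "set p \<subseteq> R" "y \<in> R" "s \<in> R"
    using ys assms by auto
  have "s \<otimes> word_prod p = word_prod p \<otimes> y \<otimes> (inv (word_prod p) \<otimes> word_prod p)"
    by (subst s) (use sub in \<open>simp add: m_assoc sub_R_carrier\<close>)
  then have sp: "s \<otimes> word_prod p = word_prod p \<otimes> y"
    using sub by (simp add: sub_R_carrier)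
  then have eq: "word_prod (s # p) = word_prod (p @ [y])"
    using sub by (simp add: sub_R_carrier)
  have "distinct (s # p)" "set (s # p) = set (p @ [y])"
    using same_length_distinct[of "p @ [y]" "s # p"] eq sub ys assms by auto
  then have "s = y" by auto
  then show thesis
    using that ys sp by blast
qed

text \<open>
  If \<open>p = s p'\<close>, then \<open>r s p'\<close> and \<open>s p' r\<close> have the same product. Moving \<open>s\<close> to the front of the
  first word by the exchange property shows that \<open>s\<close> commutes with the only letter before it,
  \<open>r\<close>. Cancelling \<open>s\<close> leaves the same situation for \<open>p'\<close>.
\<close>

lemma commute_letters:
  assumes "set p \<subseteq> R" "r \<in> R" "distinct (r # p)" "r \<otimes> word_prod p = word_prod p \<otimes> r"
  shows "\<forall>y\<in>set p. r \<otimes> y = y \<otimes> r"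
  using assms
proof (induction p)
  case (Cons s p)
  have sub: "set p \<subseteq> R" "s \<in> R" "r \<in> R"
    using Cons.prems by auto
  have eq: "word_prod (r # s # p) = word_prod (s # p @ [r])"
    using Cons.prems by (simp add: sub_R_carrier m_assoc)
  obtain p' q' where p': "r # s # p = p' @ s # q'" "s \<otimes> word_prod p' = word_prod p' \<otimes> s"
    using exchange_distinct[of s "p @ [r]" "r # s # p"] eq Cons.prems by auto
  have "p' = [r]"
    using p'(1) Cons.prems by (auto simp: Cons_eq_append_conv)
  then have rs: "r \<otimes> s = s \<otimes> r"
    using p' sub by simp
  have "s \<otimes> (r \<otimes> word_prod p) = s \<otimes> (word_prod p \<otimes> r)"
    using eq rs sub by (simp add: sub_R_carrier flip: m_assoc)
  then have "r \<otimes> word_prod p = word_prod p \<otimes> r"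
    using sub by (simp add: sub_R_carrier)
  then show ?case
    using Cons rs by auto
qed simp

text \<open>
  The element is its own inverse, so the reversed word has the same product. Its last letter is
  the first letter \<open>s\<close> of the given word, and the exchange property moves \<open>s\<close> to the front past all
  the other letters. So \<open>s\<close> commutes with each of them, and the product of the remaining letters
  again squares to the identity.
\<close>

lemma involution_letters_commute:
  assumes "set us \<subseteq> R" "distinct us" "word_prod us \<otimes> word_prod us = \<one>"
  shows "\<forall>x\<in>set us. \<forall>y\<in>set us. x \<otimes> y = y \<otimes> x"
  using assms
proof (induction us)
  case (Cons s us)
  have sub: "set us \<subseteq> R" "s \<in> R" "set us \<subseteq> carrier W" "s \<in> carrier W"
    using Cons.prems by (auto simp: sub_R_carrier)
  have "word_prod (s # us) = inv (word_prod (s # us))"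
    using Cons.prems(3) sub by (intro inv_equality[symmetric]) auto
  then have "word_prod (rev us @ [s]) = word_prod (s # us)"
    using inv_word_prod[of "s # us"] sub by simp
  then obtain p q where p: "rev us @ [s] = p @ s # q" "s \<otimes> word_prod p = word_prod p \<otimes> s"
    using exchange_distinct[of s us "rev us @ [s]"] Cons.prems by auto
  have "p = rev us"
    using p(1) Cons.prems append_Cons_eq_iff[of s "rev us" "[]" p q] by simp
  then have comm: "\<forall>y\<in>set us. s \<otimes> y = y \<otimes> s"
    using commute_letters[of p s] p Cons.prems by auto
  then have "s \<otimes> word_prod us = word_prod us \<otimes> s"
    using sub by (intro word_prod_commute) auto
  then have "\<one> = s \<otimes> word_prod us \<otimes> (word_prod us \<otimes> s)"
    using Cons.prems(3) by simp
  also have "\<dots> = s \<otimes> (word_prod us \<otimes> word_prod us) \<otimes> s"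
    using sub by (simp add: m_assoc)
  finally have one: "s \<otimes> (word_prod us \<otimes> word_prod us) \<otimes> s = \<one>"
    by simp
  have "word_prod us \<otimes> word_prod us = s \<otimes> (s \<otimes> (word_prod us \<otimes> word_prod us) \<otimes> s) \<otimes> s"
    using sub by (simp add: m_assoc generator_cancel)
  then have "word_prod us \<otimes> word_prod us = \<one>"
    using sub by (simp add: one)
  then have "\<forall>x\<in>set us. \<forall>y\<in>set us. x \<otimes> y = y \<otimes> x"
    using Cons.IH Cons.prems by simp
  then show ?case
    using comm by (metis set_ConsD)
qed simp

lemma commuting_prod_unique:
  assumes "set us \<subseteq> carrier W" "distinct us" "distinct ds" "set us = set ds"
    and "\<forall>x\<in>set us. \<forall>y\<in>set us. x \<otimes> y = y \<otimes> x"
  shows "word_prod us = word_prod ds"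
  using assms
proof (induction us arbitrary: ds)
  case (Cons x us)
  obtain p q where ds: "ds = p @ x # q"
    using Cons.prems by (metis list.set_intros(1) split_list)
  have sub: "x \<in> carrier W" "set p \<subseteq> carrier W" "set q \<subseteq> carrier W"
    using Cons.prems ds by auto
  have comm: "\<forall>y\<in>set us. \<forall>z\<in>set us. y \<otimes> z = z \<otimes> y"
    using Cons.prems(5) by (meson list.set_intros(2))
  have us: "set us = set (p @ q)"
    using Cons.prems(2,3,4) ds by auto
  have IH: "word_prod us = word_prod (p @ q)"
    using Cons.prems(1,2,3) ds us comm by (intro Cons.IH) auto
  have "\<forall>y\<in>set p. x \<otimes> y = y \<otimes> x"
    using Cons.prems(5) us by (metis UnI1 list.set_intros set_append)
  then have xp: "x \<otimes> word_prod p = word_prod p \<otimes> x"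
    using sub by (intro word_prod_commute)
  have "word_prod ds = word_prod p \<otimes> x \<otimes> word_prod q"
    using sub ds by (simp add: m_assoc)
  also have "word_prod p \<otimes> x = x \<otimes> word_prod p"
    using xp by simp
  also have "x \<otimes> word_prod p \<otimes> word_prod q = word_prod (x # us)"
    using sub IH by (simp add: m_assoc)
  finally show ?case by simp
qed simp

lemma commuting_prod_square:
  assumes "set us \<subseteq> R" "\<forall>x\<in>set us. \<forall>y\<in>set us. x \<otimes> y = y \<otimes> x"
  shows "word_prod us \<otimes> word_prod us = \<one>"
  using assms
proof (induction us)
  case (Cons s us)
  have sub: "s \<in> R" "set us \<subseteq> carrier W"
    using Cons.prems by (auto simp: sub_R_carrier)
  have "\<forall>y\<in>set us. s \<otimes> y = y \<otimes> s"
    using Cons.prems(2) by (meson list.set_intros)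
  then have "s \<otimes> word_prod us = word_prod us \<otimes> s"
    using sub by (intro word_prod_commute) auto
  then have "word_prod (s # us) \<otimes> word_prod (s # us) = (word_prod us \<otimes> s) \<otimes> (s \<otimes> word_prod us)"
    by simp
  also have "\<dots> = word_prod us \<otimes> word_prod us"
    using sub by (simp add: m_assoc generator_cancel)
  also have "\<dots> = \<one>"
    using Cons.prems by (intro Cons.IH) (simp, meson list.set_intros(2))
  finally show ?case .
qed simp


section \<open>Ancestors of products without repeated letters\<close>

text \<open>
  In a word without repeated letters, order the letters by the transitive closure of ``earlier and
  not commuting''. The sources are the minimal elements of this partial order.
\<close>

definition is_source :: "'a list \<Rightarrow> 'a \<Rightarrow> bool" where
  "is_source xs x \<longleftrightarrow> (\<exists>p q. xs = p @ x # q \<and> (\<forall>y\<in>set p. x \<otimes> y = y \<otimes> x))"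

definition sources :: "'a list \<Rightarrow> 'a list" where
  "sources xs = filter (is_source xs) xs"

definition non_sources :: "'a list \<Rightarrow> 'a list" where
  "non_sources xs = filter (\<lambda>x. \<not> is_source xs x) xs"

lemma sources_sub: "set (sources xs) \<subseteq> set xs"
  and non_sources_sub: "set (non_sources xs) \<subseteq> set xs"
  and set_sources: "set (sources xs) = {x. is_source xs x}"
  and set_non_sources: "set (non_sources xs) = set xs - set (sources xs)"
  by (auto simp: sources_def non_sources_def is_source_def)

lemma distinct_sources: "distinct xs \<Longrightarrow> distinct (sources xs @ non_sources xs)"
  by (auto simp: sources_def non_sources_def)

lemma is_source_hd: "is_source (x # xs) x"
  unfolding is_source_def by (rule exI[of _ "[]"]) auto

lemma sources_nonempty: "xs \<noteq> [] \<Longrightarrow> sources xs \<noteq> []"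
  using is_source_hd by (cases xs) (auto simp: sources_def)

lemma length_non_sources: "xs \<noteq> [] \<Longrightarrow> length (non_sources xs) < length xs"
  using is_source_hd by (cases xs) (auto simp: non_sources_def le_imp_less_Suc)

lemma sorted_wrt_source:
  assumes "distinct xs"
  shows "sorted_wrt (\<lambda>y x. is_source xs x \<longrightarrow> y \<otimes> x = x \<otimes> y) xs"
  unfolding sorted_wrt_iff_nth_less
proof (intro allI impI)
  fix i j assume ij: "i < j" "j < length xs" and "is_source xs (xs ! j)"
  then obtain p q where pq: "xs = p @ xs ! j # q" "\<forall>y\<in>set p. xs ! j \<otimes> y = y \<otimes> xs ! j"
    unfolding is_source_def by blast
  then have "xs ! length p = xs ! j" "length p < length xs"
    by (metis nth_append_length, metis length_append_singleton length_append length_Cons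
        less_add_Suc1 add_Suc_right)
  then have "length p = j"
    using assms ij by (simp add: nth_eq_iff_index_eq)
  then have "xs ! i \<in> set p"
    using ij pq(1) by (metis nth_append nth_mem)
  then show "xs ! i \<otimes> xs ! j = xs ! j \<otimes> xs ! i"
    using pq by simp
qed

lemma sources_commute:
  assumes "distinct xs" "x \<in> set (sources xs)" "y \<in> set (sources xs)"
  shows "x \<otimes> y = y \<otimes> x"
proof -
  have "sorted_wrt (\<lambda>y x. is_source xs x \<longrightarrow> y \<otimes> x = x \<otimes> y) (sources xs)"
    using sorted_wrt_source[OF assms(1)] by (simp add: sources_def sorted_wrt_filter)
  then have "sorted_wrt (\<lambda>y x. y \<otimes> x = x \<otimes> y) (sources xs)"
    by (rule sorted_wrt_mono_rel[rotated]) (auto simp: set_sources)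
  moreover obtain i j where "i < length (sources xs)" "j < length (sources xs)"
    "x = sources xs ! i" "y = sources xs ! j"
    using assms(2,3) by (auto simp: in_set_conv_nth)
  ultimately show ?thesis
    by (cases i j rule: linorder_cases) (auto simp: sorted_wrt_iff_nth_less)
qed

text \<open>The hypothesis lets every letter satisfying \<open>P\<close> move to the left past all letters before it.\<close>

lemma word_prod_partition:
  assumes "set xs \<subseteq> carrier W" "sorted_wrt (\<lambda>y x. P x \<longrightarrow> y \<otimes> x = x \<otimes> y) xs"
  shows "word_prod (filter P xs @ filter (\<lambda>x. \<not> P x) xs) = word_prod xs"
  using assms
proof (induction xs)
  case (Cons x xs)
  have sub: "x \<in> carrier W" "set (filter P xs) \<subseteq> carrier W"
    "set (filter (\<lambda>x. \<not> P x) xs) \<subseteq> carrier W"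
    using Cons.prems by auto
  have IH: "word_prod (filter P xs @ filter (\<lambda>x. \<not> P x) xs) = word_prod xs"
    using Cons by simp
  show ?case
  proof (cases "P x")
    case True
    then show ?thesis using IH by simp
  next
    case False
    have "\<forall>y\<in>set (filter P xs). x \<otimes> y = y \<otimes> x"
      using Cons.prems(2) unfolding sorted_wrt.simps set_filter by blast
    then have x: "x \<otimes> word_prod (filter P xs) = word_prod (filter P xs) \<otimes> x"
      using sub by (intro word_prod_commute)
    have "word_prod (filter P xs @ x # filter (\<lambda>x. \<not> P x) xs) =
        word_prod (filter P xs) \<otimes> x \<otimes> word_prod (filter (\<lambda>x. \<not> P x) xs)"
      using sub by (simp add: m_assoc)
    also have "\<dots> = x \<otimes> word_prod xs"
      using sub IH by (simp add: m_assoc flip: x)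
    finally show ?thesis
      using False by simp
  qed
qed simp

lemma word_prod_sources:
  assumes "set xs \<subseteq> R" "distinct xs"
  shows "word_prod xs = word_prod (sources xs @ non_sources xs)"
  using word_prod_partition[of xs "is_source xs"] sorted_wrt_source[of xs] assms
  by (simp add: sub_R_carrier sources_def non_sources_def)

text \<open>
  Reduced words of \<open>u\<close> and of the remaining factor concatenate to a word of the length of \<open>xs\<close>, which
  therefore uses the same letters, each once.
\<close>

lemma prefix_words:
  assumes "set xs \<subseteq> R" "distinct xs" "is_prefix u (word_prod xs)"
  obtains us vs where "u = word_prod us" "distinct (us @ vs)" "set (us @ vs) = set xs"
    "word_prod (us @ vs) = word_prod xs"
proof -
  obtain v where u: "u \<in> carrier W" "v \<in> carrier W" "word_prod xs = u \<otimes> v"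
    "word_length (word_prod xs) = word_length u + word_length v"
    using assms(3) by (auto simp: is_prefix_def)
  obtain us where us: "set us \<subseteq> R" "word_prod us = u" "word_length u = length us"
    using reduced_word[OF u(1)] .
  obtain vs where vs: "set vs \<subseteq> R" "word_prod vs = v" "word_length v = length vs"
    using reduced_word[OF u(2)] .
  have "word_prod (us @ vs) = word_prod xs"
    using u us vs by (simp add: sub_R_carrier)
  moreover have "length (us @ vs) = length xs"
    using u us vs word_length_distinct[OF assms(1,2)] by simp
  ultimately show thesis
    using that[of us vs] us vs same_length_distinct[OF assms(1,2), of "us @ vs"] by auto
qed

lemma involution_iff:
  assumes "u \<in> carrier W"
  shows "ord u = 2 \<longleftrightarrow> u \<noteq> \<one> \<and> u \<otimes> u = \<one>"
proof
  assume "ord u = 2"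
  then show "u \<noteq> \<one> \<and> u \<otimes> u = \<one>"
    using pow_ord_eq_1[OF assms] assms by (auto simp: numeral_2_eq_2)
next
  assume u: "u \<noteq> \<one> \<and> u \<otimes> u = \<one>"
  then have "ord u dvd 2"
    using assms pow_eq_id[of u 2] by (simp add: numeral_2_eq_2)
  moreover have "ord u \<noteq> 1"
    using u assms pow_ord_eq_1[of u] by (metis nat_pow_eone)
  ultimately show "ord u = 2"
    using dvd_imp_le[of "ord u" 2] by (cases "ord u = 0") auto
qed

text \<open>
  The letters of an involution commute, so each of them can be put first in a word for the whole
  element. Comparing that word with \<open>xs\<close> shows that the letter is a source of \<open>xs\<close>.
\<close>

lemma involution_prefix_sources:
  assumes "set xs \<subseteq> R" "distinct xs" "u \<in> involution_prefixes (word_prod xs)"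
  obtains us where "u = word_prod us" "distinct us" "set us \<subseteq> set (sources xs)"
proof -
  have u: "is_prefix u (word_prod xs)" "ord u = 2"
    using assms(3) by (auto simp: involution_prefixes_def)
  obtain us vs where us: "u = word_prod us" "distinct (us @ vs)" "set (us @ vs) = set xs"
    "word_prod (us @ vs) = word_prod xs"
    using prefix_words[OF assms(1,2) u(1)] .
  have sub: "set us \<subseteq> R" "set vs \<subseteq> R" "set us \<subseteq> carrier W" "set vs \<subseteq> carrier W"
    using us assms by (auto simp: sub_R_carrier)
  have "u \<otimes> u = \<one>"
    using u us sub involution_iff[of u] by auto
  then have comm: "\<forall>x\<in>set us. \<forall>y\<in>set us. x \<otimes> y = y \<otimes> x"
    using involution_letters_commute[of us] us sub by auto
  have "is_source xs s" if s: "s \<in> set us" for s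
  proof -
    obtain p q where pq: "us = p @ s # q"
      using split_list[OF s] by auto
    have front: "word_prod us = word_prod (s # p @ q)"
      using sub(3) pq us(2) by (intro commuting_prod_unique[OF _ _ _ _ comm]) auto
    have "word_prod xs = word_prod us \<otimes> word_prod vs"
      using us(4) sub by simp
    then have "word_prod xs = word_prod (s # p @ q @ vs)"
      unfolding front using sub pq by (simp add: m_assoc)
    moreover have "set (s # p @ q @ vs) \<subseteq> R" "distinct (s # p @ q @ vs)"
      using us pq sub by auto
    ultimately obtain p' q' where p': "xs = p' @ s # q'" "s \<otimes> word_prod p' = word_prod p' \<otimes> s"
      using exchange_distinct[of s "p @ q @ vs" xs] assms by blast
    then have "\<forall>y\<in>set p'. s \<otimes> y = y \<otimes> s"
      using assms by (intro commute_letters) auto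
    then show ?thesis
      using p' by (auto simp: is_source_def)
  qed
  then show thesis
    using that[of us] us by (auto simp: set_sources)
qed

text \<open>
  The product of all sources is an involution and a prefix. Any other involution that is a prefix
  uses only some of the sources and is shorter.
\<close>

lemma ancestor_distinct_word:
  assumes "set xs \<subseteq> R" "distinct xs" "xs \<noteq> []"
  shows "has_ancestor (word_prod xs)" "ancestor (word_prod xs) = word_prod (sources xs)"
proof -
  define D where "D = sources xs"
  define E where "E = non_sources xs"
  define I where "I = involution_prefixes (word_prod xs)"
  have sub: "set D \<subseteq> R" "set E \<subseteq> R"
    using assms sources_sub[of xs] non_sources_sub[of xs] by (auto simp: D_def E_def)
  have dist: "distinct D" "distinct E" "distinct (D @ E)"
    using distinct_sources[OF assms(2)] by (auto simp: D_def E_def)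
  have DE: "word_prod xs = word_prod D \<otimes> word_prod E"
    using word_prod_sources[OF assms(1,2)] sub by (simp add: D_def E_def sub_R_carrier)
  have comm: "\<forall>x\<in>set D. \<forall>y\<in>set D. x \<otimes> y = y \<otimes> x"
    using sources_commute[OF assms(2)] by (auto simp: D_def)
  have one: "word_prod ys \<noteq> \<one>" if "set ys \<subseteq> R" "distinct ys" "ys \<noteq> []" for ys
    using word_length_distinct[of ys] word_length_distinct[of "[]"] that by auto
  have "length xs = length D + length E"
    unfolding D_def E_def sources_def non_sources_def by (simp add: sum_length_filter_compl)
  then have "is_prefix (word_prod D) (word_prod xs)"
    unfolding is_prefix_def using sub dist DE word_length_distinct[OF assms(1,2)]
    by (auto simp: word_length_distinct sub_R_carrier intro!: bexI[of _ "word_prod E"])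
  moreover have "ord (word_prod D) = 2"
    using commuting_prod_square[OF sub(1) comm] one[OF sub(1) dist(1)] sources_nonempty[OF assms(3)] sub
    by (subst involution_iff) (auto simp: D_def sub_R_carrier)
  ultimately have DI: "word_prod D \<in> I"
    by (simp add: I_def involution_prefixes_def)
  have both: "word_length u \<le> length D \<and> (word_length u = length D \<longrightarrow> u = word_prod D)"
    if u: "u \<in> I" for u
  proof -
    obtain us where us: "u = word_prod us" "distinct us" "set us \<subseteq> set D"
      using involution_prefix_sources[OF assms(1,2)] u unfolding I_def D_def by blast
    have "word_length u = card (set us)"
      using us(3) sub(1) word_length_distinct[OF _ us(2)] distinct_card[OF us(2)]
      unfolding us(1) D_def by simp
    moreover have "card (set us) \<le> card (set D)"
      using us by (simp add: card_mono)
    moreover have "u = word_prod D" if "card (set us) = card (set D)"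
    proof -
      have eq: "set us = set D"
        using that us by (simp add: card_subset_eq)
      have "word_prod us = word_prod D"
      proof (rule commuting_prod_unique)
        show "\<forall>x\<in>set us. \<forall>y\<in>set us. x \<otimes> y = y \<otimes> x"
          unfolding eq by (rule comm)
      qed (use us eq dist sub in \<open>simp_all add: sub_R_carrier\<close>)
      then show ?thesis
        using us(1) by simp
    qed
    ultimately show ?thesis
      unfolding distinct_card[OF dist(1)] by metis
  qed
  have bound: "word_length u \<le> length D" if "u \<in> I" for u
    using both[OF that] by (rule conjunct1)
  have lenD: "word_length (word_prod D) = length D"
    using sub dist by (simp add: word_length_distinct)
  have "Max (word_length ` I) = length D"
  proof (rule Max_eqI)
    show "finite (word_length ` I)"
      using bound by (auto intro: finite_subset[of _ "{..length D}", OF _ finite_atMost])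
    show "length D \<in> word_length ` I"
      using imageI[OF DI, of word_length] unfolding lenD .
  qed (use bound in auto)
  then have "longest_involution_prefixes (word_prod xs) = {u \<in> I. word_length u = length D}"
    unfolding longest_involution_prefixes_def I_def by simp
  also have "\<dots> = {word_prod D}"
  proof
    show "{u \<in> I. word_length u = length D} \<subseteq> {word_prod D}"
      using both by blast
  qed (use DI lenD in simp)
  finally have "longest_involution_prefixes (word_prod xs) = {word_prod D}" .
  then show "has_ancestor (word_prod xs)" "ancestor (word_prod xs) = word_prod (sources xs)"
    using one[OF assms] by (simp_all add: has_ancestor_def ancestor_def D_def)
qed


section \<open>A recursion for the involution length\<close>

lemma ancestor_closed:
  assumes "has_ancestor w"
  shows "ancestor w \<in> carrier W"
proof -
  obtain a where a: "longest_involution_prefixes w = {a}"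
    using assms by (auto simp: has_ancestor_def card_1_singleton_iff)
  then have "is_prefix a w"
    by (auto simp: longest_involution_prefixes_def involution_prefixes_def)
  then show ?thesis
    by (simp add: ancestor_def a is_prefix_def)
qed

text \<open>
  The definition of a decomposition does not place its terms in the group explicitly; this is what
  allows the first term to be cancelled in \<open>decomposition_distinct_word\<close>.
\<close>

lemma decomposition_closed: "ancestor_decomposition w us \<Longrightarrow> set us \<subseteq> carrier W"
  by (auto simp: ancestor_decomposition_def in_set_conv_nth ancestor_closed)

lemma decomposition_Nil: "ancestor_decomposition w [] \<longleftrightarrow> w = \<one>"
  by (auto simp: ancestor_decomposition_def)

lemma decomposition_Cons:
  "ancestor_decomposition w (u # us) \<longleftrightarrow>
     w = u \<otimes> word_prod us \<and> has_ancestor w \<and> u = ancestor w \<and>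
     ancestor_decomposition (word_prod us) us"
  unfolding ancestor_decomposition_def length_Cons All_less_Suc2 drop_0 drop_Suc_Cons
    nth_Cons_0 nth_Cons_Suc word_prod_Cons
  by metis

lemma decomposition_one: "ancestor_decomposition \<one> us \<longleftrightarrow> us = []"
  by (cases us) (auto simp: decomposition_Nil decomposition_Cons has_ancestor_def)

lemma decomposition_distinct_word:
  assumes "set xs \<subseteq> R" "distinct xs" "xs \<noteq> []"
  shows "ancestor_decomposition (word_prod xs) us \<longleftrightarrow>
    (\<exists>vs. us = word_prod (sources xs) # vs \<and> ancestor_decomposition (word_prod (non_sources xs)) vs)"
proof -
  have sub: "set (sources xs) \<subseteq> carrier W" "set (non_sources xs) \<subseteq> carrier W"
    using assms sources_sub[of xs] non_sources_sub[of xs] by (auto simp: sub_R_carrier)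
  have prod: "word_prod xs = word_prod (sources xs) \<otimes> word_prod (non_sources xs)"
    using word_prod_sources[OF assms(1,2)] sub by simp
  have anc: "has_ancestor (word_prod xs)" "ancestor (word_prod xs) = word_prod (sources xs)"
    using ancestor_distinct_word[OF assms] .
  show ?thesis
  proof (cases us)
    case Nil
    then show ?thesis
      using anc by (auto simp: decomposition_Nil has_ancestor_def)
  next
    case (Cons u vs)
    have "ancestor_decomposition (word_prod (non_sources xs)) vs"
      if "word_prod xs = word_prod (sources xs) \<otimes> word_prod vs" "ancestor_decomposition (word_prod vs) vs"
    proof -
      have "word_prod vs = word_prod (non_sources xs)"
        using that prod decomposition_closed[OF that(2)] sub by simp
      then show ?thesis using that(2) by simp
    qed
    moreover have "word_prod vs = word_prod (non_sources xs)"
      if "ancestor_decomposition (word_prod (non_sources xs)) vs"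
      using that by (simp add: ancestor_decomposition_def)
    ultimately show ?thesis
      unfolding Cons decomposition_Cons using anc prod by (metis list.inject)
  qed
qed

lemma decomposition_ex1:
  assumes "set xs \<subseteq> R" "distinct xs"
  shows "\<exists>!us. ancestor_decomposition (word_prod xs) us"
  using assms
proof (induction xs rule: length_induct)
  case (1 xs)
  show ?case
  proof (cases "xs = []")
    case True
    then show ?thesis by (simp add: decomposition_one)
  next
    case False
    have "set (non_sources xs) \<subseteq> R" "distinct (non_sources xs)"
      using 1 non_sources_sub[of xs] distinct_sources[of xs] by auto
    then have "\<exists>!us. ancestor_decomposition (word_prod (non_sources xs)) us"
      using 1 length_non_sources[OF False] by blast
    then show ?thesis
      using decomposition_distinct_word[of xs] 1 False by auto
  qed
qed

lemma involution_length_one: "involution_length \<one> = 0"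
  by (simp add: involution_length_def decomposition_one)

lemma involution_length_rec:
  assumes "set xs \<subseteq> R" "distinct xs" "xs \<noteq> []"
  shows "involution_length (word_prod xs) = Suc (involution_length (word_prod (non_sources xs)))"
proof -
  have "set (non_sources xs) \<subseteq> R" "distinct (non_sources xs)"
    using assms non_sources_sub[of xs] distinct_sources[of xs] by auto
  then obtain vs where vs: "ancestor_decomposition (word_prod (non_sources xs)) vs"
    "(THE us. ancestor_decomposition (word_prod (non_sources xs)) us) = vs"
    using decomposition_ex1 by (metis the1_equality)
  have "ancestor_decomposition (word_prod xs) (word_prod (sources xs) # vs)"
    using vs decomposition_distinct_word[OF assms] by blast
  then have "(THE us. ancestor_decomposition (word_prod xs) us) = word_prod (sources xs) # vs"
    using decomposition_ex1[OF assms(1,2)] by (simp add: the1_equality)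
  then show ?thesis
    using vs by (simp add: involution_length_def)
qed


section \<open>Colourings of the Coxeter graph\<close>

lemma proper_colouring_iff:
  "proper_colouring R coxeter_graph_edges k c \<longleftrightarrow>
     c ` R \<subseteq> {..<k} \<and> (\<forall>x\<in>R. \<forall>y\<in>R. x \<otimes> y \<noteq> y \<otimes> x \<longrightarrow> c x \<noteq> c y)"
  unfolding proper_colouring_def coxeter_graph_edges_def
  by (auto simp: doubleton_eq_iff) metis+

text \<open>The colour of a letter is the number of layers of sources peeled off before it.\<close>

lemma colouring_from_word:
  assumes "set xs \<subseteq> R" "distinct xs"
  shows "\<exists>c. c ` set xs \<subseteq> {..<involution_length (word_prod xs)} \<and>
    (\<forall>x\<in>set xs. \<forall>y\<in>set xs. x \<otimes> y \<noteq> y \<otimes> x \<longrightarrow> c x \<noteq> c y)"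
  using assms
proof (induction xs rule: length_induct)
  case (1 xs)
  show ?case
  proof (cases "xs = []")
    case False
    have "set (non_sources xs) \<subseteq> R" "distinct (non_sources xs)"
      using 1 non_sources_sub[of xs] distinct_sources[of xs] by auto
    then obtain c where c:
      "c ` set (non_sources xs) \<subseteq> {..<involution_length (word_prod (non_sources xs))}"
      "\<forall>x\<in>set (non_sources xs). \<forall>y\<in>set (non_sources xs). x \<otimes> y \<noteq> y \<otimes> x \<longrightarrow> c x \<noteq> c y"
      using 1 length_non_sources[OF False] by blast
    define c' where "c' x = (if x \<in> set (sources xs) then 0 else Suc (c x))" for x
    have "c' ` set xs \<subseteq> {..<involution_length (word_prod xs)}"
      using c(1) involution_length_rec[of xs] 1 False by (auto simp: c'_def set_non_sources)
    moreover have "c' x \<noteq> c' y" if "x \<in> set xs" "y \<in> set xs" "x \<otimes> y \<noteq> y \<otimes> x" for x y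
      using that c(2) sources_commute[of xs x y] 1 by (auto simp: c'_def set_non_sources)
    ultimately show ?thesis by blast
  qed simp
qed

text \<open>
  A letter of the lowest possible colour \<open>j\<close> is preceded only by letters of colour \<open>j\<close>, which commute
  with it, so it is a source. What remains after removing the sources is sorted and has colours
  from \<open>j + 1\<close> on. The lower bound \<open>j\<close> is variable for the sake of this induction.
\<close>

lemma involution_length_sorted_le:
  assumes "set xs \<subseteq> R" "distinct xs" "sorted (map c xs)" "c ` set xs \<subseteq> {j..<k}"
    and "\<forall>x\<in>R. \<forall>y\<in>R. x \<otimes> y \<noteq> y \<otimes> x \<longrightarrow> c x \<noteq> c y"
  shows "involution_length (word_prod xs) \<le> k - (j :: nat)"
  using assms
proof (induction xs arbitrary: j rule: length_induct)
  case (1 xs)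
  note sub = "1.prems"(1) and dist = "1.prems"(2) and sorted = "1.prems"(3)
    and range = "1.prems"(4) and proper = "1.prems"(5)
  show ?case
  proof (cases "xs = []")
    case True
    then show ?thesis by (simp add: involution_length_one)
  next
    case False
    have lowest: "is_source xs x" if x: "x \<in> set xs" "c x = j" for x
    proof -
      obtain p q where pq: "xs = p @ x # q"
        using split_list[OF x(1)] by auto
      have "x \<otimes> y = y \<otimes> x" if y: "y \<in> set p" for y
      proof -
        have "c y \<le> c x"
          using y sorted pq by (auto simp: sorted_append)
        moreover have "j \<le> c y"
          using y range pq by auto
        ultimately have "c x = c y"
          using x(2) by simp
        moreover have "x \<in> R" "y \<in> R"
          using sub pq y by auto
        ultimately show ?thesis
          using proper by blast
      qed
      then show ?thesis
        using pq unfolding is_source_def by blast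
    qed
    have "j < k"
      using False range by (cases xs) auto
    have "Suc j \<le> c x \<and> c x < k" if x: "x \<in> set (non_sources xs)" for x
    proof -
      have "x \<in> set xs" "\<not> is_source xs x"
        using x by (auto simp: non_sources_def)
      then have "c x \<noteq> j" "c x \<in> {j..<k}"
        using lowest range by blast+
      then show ?thesis by simp
    qed
    then have "c ` set (non_sources xs) \<subseteq> {Suc j..<k}"
      by auto
    moreover have "set (non_sources xs) \<subseteq> R" "distinct (non_sources xs)"
      "sorted (map c (non_sources xs))"
      using sub dist sorted by (auto simp: non_sources_def sorted_filter)
    ultimately have "involution_length (word_prod (non_sources xs)) \<le> k - Suc j"
      using "1.IH" length_non_sources[OF False] proper by blast
    then show ?thesis
      using involution_length_rec[OF sub dist False] \<open>j < k\<close> by simp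
  qed
qed

lemma Min_involution_length:
  assumes "finite R"
  shows "Min (involution_length ` coxeter_elements) = chromatic_number R coxeter_graph_edges"
proof -
  let ?col = "\<lambda>k. \<exists>c. proper_colouring R coxeter_graph_edges k c"
  have "finite {xs. set xs = R \<and> distinct xs}"
    by (rule finite_subset[OF _ finite_subset_distinct[OF assms]]) auto
  moreover have "coxeter_elements = word_prod ` {xs. set xs = R \<and> distinct xs}"
    by (auto simp: coxeter_elements_def)
  ultimately have fin: "finite (involution_length ` coxeter_elements)"
    by simp
  have col: "?col (involution_length w)" if w: "w \<in> coxeter_elements" for w
  proof -
    obtain xs where "w = word_prod xs" "distinct xs" "set xs = R"
      using w by (auto simp: coxeter_elements_def)
    then show ?thesis
      using colouring_from_word[of xs] by (simp add: proper_colouring_iff)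
  qed
  have ordering: "\<exists>w\<in>coxeter_elements. involution_length w \<le> k" if col: "?col k" for k
  proof -
    obtain c where c: "proper_colouring R coxeter_graph_edges k c"
      using col by blast
    obtain xs where xs: "set xs = R" "distinct xs"
      using finite_distinct_list[OF assms] by auto
    have "involution_length (word_prod (sort_key c xs)) \<le> k - 0"
    proof (rule involution_length_sorted_le)
      show "c ` set (sort_key c xs) \<subseteq> {0..<k}"
        using c xs(1) by (simp add: proper_colouring_iff atLeast0LessThan)
      show "\<forall>x\<in>R. \<forall>y\<in>R. x \<otimes> y \<noteq> y \<otimes> x \<longrightarrow> c x \<noteq> c y"
        using c unfolding proper_colouring_iff by (rule conjunct2)
    qed (use xs in simp_all)
    moreover have "word_prod (sort_key c xs) \<in> coxeter_elements"
      unfolding coxeter_elements_def using xs by (intro CollectI exI[of _ "sort_key c xs"]) simp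
    ultimately show ?thesis by (metis diff_zero)
  qed
  obtain xs where "set xs = R" "distinct xs"
    using finite_distinct_list[OF assms] by auto
  then have "word_prod xs \<in> coxeter_elements"
    by (auto simp: coxeter_elements_def)
  then have "?col (chromatic_number R coxeter_graph_edges)"
    unfolding chromatic_number_def by (rule LeastI[of ?col, OF col])
  then obtain w where w: "w \<in> coxeter_elements"
    "involution_length w \<le> chromatic_number R coxeter_graph_edges"
    using ordering by blast
  have le: "chromatic_number R coxeter_graph_edges \<le> involution_length v" if "v \<in> coxeter_elements" for v
    unfolding chromatic_number_def using col[OF that] by (rule Least_le)
  show ?thesis
  proof (rule Min_eqI[OF fin])
    show "chromatic_number R coxeter_graph_edges \<le> n" if "n \<in> involution_length ` coxeter_elements" for n
      using that le by auto
    show "chromatic_number R coxeter_graph_edges \<in> involution_length ` coxeter_elements"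
      using le_antisym[OF w(2) le[OF w(1)]] imageI[OF w(1), of involution_length] by simp
  qed
qed

end

theorem lemma2p3:
  fixes W :: "('a, 'b) monoid_scheme" and R :: "'a set"
  assumes "coxeter_system W R" and "finite R"
  shows "Min (coxeter_system.involution_length W R ` coxeter_system.coxeter_elements W R) =
         chromatic_number R (coxeter_system.coxeter_graph_edges W R)"
  using coxeter_system.Min_involution_length[OF assms] .

end
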